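(* Let $(\mathcal V^1_{WP}\oplus\mathcal V^2_{\dot W\dot P})\leftrightarrow\mathcal V_{W\dot WM_uM_y}=\mathcal V_{P\dot PM_uM_y}$ and let $\mathcal V^2_{\dot W\dot P}\circ\dot W\supseteq\mathcal V_{W\dot WM_uM_y}\times W\dot WM_y\circ\dot W$. Let $\mathcal V_{\dot WM_y}$ be a linear subspace of vectors on $\dot W\uplus M_y$ and let $\mathcal V_{\dot PM_y}:=\mathcal V_{\dot WM_y}\leftrightarrow\mathcal V^2_{\dot W\dot P}$. Let $\mathcal V_{W\dot W}:=(\mathcal V_{W\dot WM_uM_y}+\mathcal V_{\dot WM_y})\times W\dot W$ and $\mathcal V_{P\dot P}:=(\mathcal V_{P\dot PM_uM_y}+\mathcal V_{\dot PM_y})\times P\dot P$. Then $$(\mathcal V^1_{WP}\oplus\mathcal V^2_{\dot W\dot P})\leftrightarrow\mathcal V_{W\dot W}=\mathcal V_{P\dot P}.$$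
   Context: Fix a field $\mathbb F$; all index sets are finite. A vector on $X$ is a function $X\to\mathbb F$. $W,\dot W$ are disjoint copies of each other (in bijection), $P,\dot P$ likewise, and $W,\dot W,P,\dot P,M_u,M_y$ are pairwise disjoint. $\mathcal V_{W\dot WM_uM_y}$, $\mathcal V_{P\dot PM_uM_y}$, $\mathcal V^1_{WP}$, $\mathcal V^2_{\dot W\dot P}$ denote linear subspaces of vectors on the indicated disjoint unions. For $T\subseteq S$: $\mathcal V_S\circ T$ is the set of restrictions to $T$ of vectors in $\mathcal V_S$; $\mathcal V_S\times T:=\{f_T:(f_T,0_{S\setminus T})\in\mathcal V_S\}$; such operations are applied left to right. For spaces on sets $X,Y$: $\mathcal V_X+\mathcal V_Y$ is the sum on $X\cup Y$ after extending the vectors of each space by zero; $\mathcal V_X\leftrightarrow\mathcal V_Y$ is the space on $(X\setminus Y)\uplus(Y\setminus X)$ of all $(g_{X\setminus Y},h_{Y\setminus X})$ with $g\in\mathcal V_X$, $h\in\mathcal V_Y$ and $g,h$ equal on $X\cap Y$. $\oplus$ is the direct sum over disjoint index sets. *)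

theory Defs
  imports Complex_Main "HOL-Library.Function_Algebras" "HOL-Library.Set_Algebras"
begin

text \<open>
  A vector on an index set \<open>X\<close> is represented by a function on the ambient index type that
  vanishes outside \<open>X\<close>. Under this encoding a vector \<open>f\<close> on \<open>T\<close> and its extension
  \<open>(f, 0)\<close> by zero to some \<open>S \<supseteq> T\<close> are the same function. So the sum of two spaces
  after extending their vectors by zero is the elementwise set sum \<open>V + U\<close>, and the direct sum
  is \<open>V + U\<close> for spaces on disjoint index sets.
\<close>

definition vectors_on :: "'i set \<Rightarrow> ('i \<Rightarrow> 'f::field) set" where
  "vectors_on X = {f. \<forall>i. i \<notin> X \<longrightarrow> f i = 0}"

definition fscale :: "'f::field \<Rightarrow> ('i \<Rightarrow> 'f) \<Rightarrow> 'i \<Rightarrow> 'f" where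
  "fscale c f = (\<lambda>i. c * f i)"

lemma vector_space_fscale: "vector_space fscale"
  by unfold_locales (auto simp: fscale_def fun_eq_iff algebra_simps)

definition space_on :: "'i set \<Rightarrow> ('i \<Rightarrow> 'f::field) set \<Rightarrow> bool" where
  "space_on X V \<longleftrightarrow> V \<subseteq> vectors_on X \<and> module.subspace fscale V"

text \<open>The space \<open>V \<circ> T\<close>.\<close>

definition restriction :: "('i \<Rightarrow> 'f::field) set \<Rightarrow> 'i set \<Rightarrow> ('i \<Rightarrow> 'f) set" where
  "restriction V T = (\<lambda>f i. if i \<in> T then f i else 0) ` V"

text \<open>The space \<open>V \<times> T\<close>. Since \<open>(f, 0)\<close> is \<open>f\<close> itself, the index set
  of \<open>V\<close> need not be given.\<close>

definition contraction :: "('i \<Rightarrow> 'f::field) set \<Rightarrow> 'i set \<Rightarrow> ('i \<Rightarrow> 'f) set" where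
  "contraction V T = {f \<in> vectors_on T. f \<in> V}"

text \<open>The space \<open>V \<leftrightarrow> U\<close> for \<open>V\<close> on \<open>X\<close> and \<open>U\<close> on \<open>Y\<close>. The index
  sets are arguments because a set of functions does not determine them.\<close>

definition linking ::
  "'i set \<Rightarrow> ('i \<Rightarrow> 'f::field) set \<Rightarrow> 'i set \<Rightarrow> ('i \<Rightarrow> 'f) set \<Rightarrow> ('i \<Rightarrow> 'f) set" where
  "linking X V Y U =
     {(\<lambda>i. if i \<in> X - Y then g i else if i \<in> Y - X then h i else 0) | g h.
        g \<in> V \<and> h \<in> U \<and> (\<forall>i \<in> X \<inter> Y. g i = h i)}"

end

theory Submission
  imports Defs
begin

text \<open>
  Write a vector of \<open>V_WWMM\<close> as \<open>(w, w', u, y)\<close>. Unfolding the definitions, \<open>(p, p')\<close> lies in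
  the left-hand side iff there are \<open>(w, p) \<in> V1\<close>, \<open>(b, p') \<in> V2\<close> and \<open>(w, w', 0, y) \<in> V_WWMM\<close>
  with \<open>(b - w', - y) \<in> V_WM\<close>. It lies in the right-hand side iff there are \<open>(w, p) \<in> V1\<close>,
  \<open>(w', q') \<in> V2\<close>, \<open>(w, w', 0, y) \<in> V_WWMM\<close> and \<open>(d', p' - q') \<in> V2\<close> with
  \<open>(d', - y) \<in> V_WM\<close>. The two descriptions are exchanged by \<open>b = w' + d'\<close>.

  From right to left, the two vectors \<open>(w', q')\<close> and \<open>(d', p' - q')\<close> of \<open>V2\<close> add up to \<open>(b, p')\<close>.
  From left to right, \<open>(b, p')\<close> has to be split, so a \<open>q'\<close> with \<open>(w', q') \<in> V2\<close> is needed.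
  Since the \<open>Mu\<close>-part of \<open>(w, w', 0, y)\<close> is zero, this is what the inclusion
  \<open>V2 \<circ> W' \<supseteq> V_WWMM \<times> (W \<union> W' \<union> My) \<circ> W'\<close> provides; linearity of \<open>V2\<close> then gives
  \<open>(b - w', p' - q') \<in> V2\<close>.
\<close>

lemma module_fscale: "module fscale"
  using vector_space_fscale by (simp add: module_iff_vector_space)

lemma space_on_zero_outside:
  assumes "space_on X V" "f \<in> V" "i \<notin> X"
  shows "f i = 0"
  using assms by (auto simp: space_on_def vectors_on_def)

lemma space_on_add:
  assumes "space_on X V" "f \<in> V" "g \<in> V"
  shows "f + g \<in> V"
  using assms module.subspace_add[OF module_fscale] by (auto simp: space_on_def)

lemma space_on_diff:
  assumes "space_on X V" "f \<in> V" "g \<in> V"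
  shows "f - g \<in> V"
  using assms module.subspace_diff[OF module_fscale] by (auto simp: space_on_def)

text \<open>
  The glued vector of a linking is given here by its values, so that the proof can argue on each
  block of indices separately; there the disjointness of the blocks decides which condition applies.
\<close>

lemma linkingI:
  assumes "g \<in> V" "h \<in> U"
    and "\<And>i. i \<in> X \<Longrightarrow> i \<in> Y \<Longrightarrow> g i = h i"
    and "\<And>i. i \<in> X \<Longrightarrow> i \<notin> Y \<Longrightarrow> f i = g i"
    and "\<And>i. i \<in> Y \<Longrightarrow> i \<notin> X \<Longrightarrow> f i = h i"
    and "\<And>i. (i \<in> X \<longleftrightarrow> i \<in> Y) \<Longrightarrow> f i = 0"
  shows "f \<in> linking X V Y U"
proof -
  have "f = (\<lambda>i. if i \<in> X - Y then g i else if i \<in> Y - X then h i else 0)"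
    using assms by (auto simp: fun_eq_iff)
  then show ?thesis
    unfolding linking_def using assms(1-3) by blast
qed

lemma linkingE:
  assumes "f \<in> linking X V Y U"
  obtains g h where "g \<in> V" "h \<in> U"
    and "\<And>i. i \<in> X \<Longrightarrow> i \<in> Y \<Longrightarrow> g i = h i"
    and "\<And>i. i \<in> X \<Longrightarrow> i \<notin> Y \<Longrightarrow> f i = g i"
    and "\<And>i. i \<in> Y \<Longrightarrow> i \<notin> X \<Longrightarrow> f i = h i"
    and "\<And>i. (i \<in> X \<longleftrightarrow> i \<in> Y) \<Longrightarrow> f i = 0"
  using assms unfolding linking_def by auto

theorem theorem81:
  fixes W W' P P' Mu My :: "'i set"
    and dotW dotP :: "'i \<Rightarrow> 'i"
    and V_WWMM V_PPMM V1 V2 V_WM V_PM V_WW V_PP :: "('i \<Rightarrow> 'f::field) set"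
  assumes "finite W" "finite W'" "finite P" "finite P'" "finite Mu" "finite My"
    and "bij_betw dotW W W'" "bij_betw dotP P P'"
    and "sorted_wrt disjnt [W, W', P, P', Mu, My]"
    and "space_on (W \<union> W' \<union> Mu \<union> My) V_WWMM"
    and "space_on (P \<union> P' \<union> Mu \<union> My) V_PPMM"
    and "space_on (W \<union> P) V1"
    and "space_on (W' \<union> P') V2"
    and "linking (W \<union> P \<union> W' \<union> P') (V1 + V2) (W \<union> W' \<union> Mu \<union> My) V_WWMM = V_PPMM"
    and "restriction V2 W' \<supseteq> restriction (contraction V_WWMM (W \<union> W' \<union> My)) W'"
    and "space_on (W' \<union> My) V_WM"
    and "V_PM = linking (W' \<union> My) V_WM (W' \<union> P') V2"
    and "V_WW = contraction (V_WWMM + V_WM) (W \<union> W')"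
    and "V_PP = contraction (V_PPMM + V_PM) (P \<union> P')"
  shows "linking (W \<union> P \<union> W' \<union> P') (V1 + V2) (W \<union> W') V_WW = V_PP"
proof -
  note lin_V = assms(10) and lin_V1 = assms(12) and lin_V2 = assms(13) and lin_VM = assms(16)
  note V_zero = space_on_zero_outside[OF lin_V] and V1_zero = space_on_zero_outside[OF lin_V1]
    and V2_zero = space_on_zero_outside[OF lin_V2] and VM_zero = space_on_zero_outside[OF lin_VM]
  have disj: "\<And>i. i \<in> W \<Longrightarrow> i \<notin> W' \<and> i \<notin> P \<and> i \<notin> P' \<and> i \<notin> Mu \<and> i \<notin> My"
    "\<And>i. i \<in> W' \<Longrightarrow> i \<notin> W \<and> i \<notin> P \<and> i \<notin> P' \<and> i \<notin> Mu \<and> i \<notin> My"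
    "\<And>i. i \<in> P \<Longrightarrow> i \<notin> W \<and> i \<notin> W' \<and> i \<notin> P' \<and> i \<notin> Mu \<and> i \<notin> My"
    "\<And>i. i \<in> P' \<Longrightarrow> i \<notin> W \<and> i \<notin> W' \<and> i \<notin> P \<and> i \<notin> Mu \<and> i \<notin> My"
    "\<And>i. i \<in> Mu \<Longrightarrow> i \<notin> W \<and> i \<notin> W' \<and> i \<notin> P \<and> i \<notin> P' \<and> i \<notin> My"
    "\<And>i. i \<in> My \<Longrightarrow> i \<notin> W \<and> i \<notin> W' \<and> i \<notin> P \<and> i \<notin> P' \<and> i \<notin> Mu"
    using assms(9) by (auto simp: disjnt_iff)
  show ?thesis
  proof (rule equalityI; rule subsetI)
    fix r
    assume "r \<in> linking (W \<union> P \<union> W' \<union> P') (V1 + V2) (W \<union> W') V_WW"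
    then obtain f g where f: "f \<in> V1 + V2" and g: "g \<in> V_WW"
      and link: "\<And>i. i \<in> W \<union> P \<union> W' \<union> P' \<Longrightarrow> i \<in> W \<union> W' \<Longrightarrow> f i = g i"
        "\<And>i. i \<in> W \<union> P \<union> W' \<union> P' \<Longrightarrow> i \<notin> W \<union> W' \<Longrightarrow> r i = f i"
        "\<And>i. i \<in> W \<union> P \<union> W' \<union> P' \<longleftrightarrow> i \<in> W \<union> W' \<Longrightarrow> r i = 0"
      by (rule linkingE) blast
    have fg: "f i = g i" if "i \<in> W \<union> W'" for i
      using that link(1)[of i] by auto
    have rf: "r i = f i" if "i \<in> P \<union> P'" for i
      using that link(2) disj by blast
    have r0: "r i = 0" if "i \<notin> P \<union> P'" for i
      using that link(3)[of i] by auto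
    obtain f1 f2 where f12: "f1 \<in> V1" "f2 \<in> V2" "f = f1 + f2"
      using f by (rule set_plus_elim)
    have g_zero: "\<And>i. i \<notin> W \<union> W' \<Longrightarrow> g i = 0" and "g \<in> V_WWMM + V_WM"
      using g by (auto simp: assms(18) contraction_def vectors_on_def)
    then obtain v m where vm: "v \<in> V_WWMM" "m \<in> V_WM" "g = v + m"
      by (auto elim: set_plus_elim)
    \<comment> \<open>Here \<open>v = (w, w', 0, y)\<close>, \<open>m = (b - w', - y)\<close> and \<open>f2 = (b, p')\<close>. The \<open>Mu\<close>-part of \<open>v\<close>
      vanishes because neither \<open>g\<close> nor \<open>m\<close> has one.\<close>
    have v_Mu: "v i = 0" if "i \<in> Mu" for i
      using g_zero[of i] VM_zero[OF vm(2), of i] disj(5)[OF that] by (auto simp: vm(3))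
    have "v \<in> contraction V_WWMM (W \<union> W' \<union> My)"
      using vm(1) V_zero[OF vm(1)] v_Mu by (auto simp: contraction_def vectors_on_def)
    then have "(\<lambda>i. if i \<in> W' then v i else 0) \<in> restriction V2 W'"
      using assms(15) by (auto simp: restriction_def)
    then obtain q where q: "q \<in> V2" and q_if:
      "(\<lambda>i. if i \<in> W' then v i else 0) = (\<lambda>i. if i \<in> W' then q i else 0)"
      by (auto simp: restriction_def)
    have qv: "q i = v i" if "i \<in> W'" for i
      using fun_cong[OF q_if, of i] that by simp
    \<comment> \<open>The splitting \<open>f2 = q + (f2 - q)\<close> inside \<open>V2\<close> matches \<open>g = v + m\<close> on \<open>W'\<close>.\<close>
    have s: "f2 - q \<in> V2"
      using lin_V2 f12(2) q by (rule space_on_diff)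
    \<comment> \<open>The summands in \<open>V_PPMM\<close> and \<open>V_PM\<close>: \<open>f1 + q\<close> glued to \<open>v\<close>, and \<open>m\<close> glued to \<open>f2 - q\<close>. Their
      \<open>My\<close>-parts are \<open>y\<close> and \<open>- y\<close>, so the sum lives on \<open>P \<union> P'\<close>.\<close>
    define x where "x = (\<lambda>i. if i \<in> P \<union> P' then f1 i + q i else if i \<in> Mu \<union> My then v i else 0)"
    define z where "z = (\<lambda>i. if i \<in> P' then f2 i - q i else if i \<in> My then m i else 0)"
    have "x \<in> V_PPMM"
      unfolding assms(14)[symmetric]
    proof (rule linkingI[OF set_plus_intro[OF f12(1) q] vm(1)])
      fix i
      assume "i \<in> W \<union> P \<union> W' \<union> P'" "i \<in> W \<union> W' \<union> Mu \<union> My"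
      then consider "i \<in> W" | "i \<in> W'" using disj(3,4) by blast
      then show "(f1 + q) i = v i"
      proof cases
        case 1
        then show ?thesis
          using fg[of i] V2_zero[OF q, of i] V2_zero[OF f12(2), of i] VM_zero[OF vm(2), of i]
            disj(1)[OF 1]
          by (auto simp: f12(3) vm(3))
      next
        case 2
        then show ?thesis
          using qv[of i] V1_zero[OF f12(1), of i] disj(2)[OF 2] by auto
      qed
    next
      fix i
      assume "i \<in> W \<union> P \<union> W' \<union> P'" "i \<notin> W \<union> W' \<union> Mu \<union> My"
      then show "x i = (f1 + q) i" by (auto simp: x_def)
    next
      fix i
      assume "i \<in> W \<union> W' \<union> Mu \<union> My" "i \<notin> W \<union> P \<union> W' \<union> P'"
      then show "x i = v i" by (auto simp: x_def)
    next
      fix i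
      assume "i \<in> W \<union> P \<union> W' \<union> P' \<longleftrightarrow> i \<in> W \<union> W' \<union> Mu \<union> My"
      then have "i \<notin> P \<union> P'" "i \<notin> Mu \<union> My" using disj(3-6) by blast+
      then show "x i = 0" by (simp add: x_def)
    qed
    moreover have "z \<in> V_PM"
      unfolding assms(17)
    proof (rule linkingI[OF vm(2) s])
      fix i
      assume "i \<in> W' \<union> My" "i \<in> W' \<union> P'"
      then have "i \<in> W'" using disj(4) by blast
      then show "m i = (f2 - q) i"
        using fg[of i] qv[of i] V1_zero[OF f12(1), of i] disj(2)[OF \<open>i \<in> W'\<close>]
        by (auto simp: f12(3) vm(3) algebra_simps)
    next
      fix i
      assume "i \<in> W' \<union> My" "i \<notin> W' \<union> P'"
      then show "z i = m i" by (auto simp: z_def)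
    next
      fix i
      assume "i \<in> W' \<union> P'" "i \<notin> W' \<union> My"
      then show "z i = (f2 - q) i" by (auto simp: z_def)
    next
      fix i
      assume "i \<in> W' \<union> My \<longleftrightarrow> i \<in> W' \<union> P'"
      then have "i \<notin> P'" "i \<notin> My" using disj(4,6) by blast+
      then show "z i = 0" by (simp add: z_def)
    qed
    moreover have "r = x + z"
    proof
      fix i
      consider "i \<in> P" | "i \<in> P'" | "i \<in> Mu" | "i \<in> My" | "i \<notin> P \<union> P' \<union> Mu \<union> My" by blast
      then show "r i = (x + z) i"
      proof cases
        case 1
        then have "q i = 0" "f2 i = 0" "i \<notin> P'" "i \<notin> My"
          using V2_zero[OF q, of i] V2_zero[OF f12(2), of i] disj(3)[OF 1] by auto
        then show ?thesis using 1 rf[of i] by (simp add: x_def z_def f12(3))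
      next
        case 2
        then have "f1 i = 0" using V1_zero[OF f12(1), of i] disj(4)[OF 2] by auto
        then show ?thesis using 2 rf[of i] by (simp add: x_def z_def f12(3))
      next
        case 3
        then show ?thesis using r0[of i] v_Mu[of i] disj(5)[OF 3] by (auto simp: x_def z_def)
      next
        case 4
        then have "v i + m i = 0" using g_zero[of i] disj(6)[OF 4] by (auto simp: vm(3))
        moreover have "i \<notin> P" "i \<notin> P'" using disj(6)[OF 4] by auto
        ultimately show ?thesis using 4 r0[of i] by (simp add: x_def z_def)
      next
        case 5
        then show ?thesis using r0[of i] by (simp add: x_def z_def)
      qed
    qed
    ultimately show "r \<in> V_PP"
      using r0 by (auto simp: assms(19) contraction_def vectors_on_def set_plus_intro)
  next
    fix r
    assume "r \<in> V_PP"
    then have r0: "\<And>i. i \<notin> P \<union> P' \<Longrightarrow> r i = 0" and "r \<in> V_PPMM + V_PM"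
      by (auto simp: assms(19) contraction_def vectors_on_def)
    then obtain x z where x: "x \<in> V_PPMM" and z: "z \<in> V_PM" and r: "r = x + z"
      by (auto elim: set_plus_elim)
    obtain f v where f: "f \<in> V1 + V2" and v: "v \<in> V_WWMM"
      and link_x: "\<And>i. i \<in> W \<union> P \<union> W' \<union> P' \<Longrightarrow> i \<in> W \<union> W' \<union> Mu \<union> My \<Longrightarrow> f i = v i"
        "\<And>i. i \<in> W \<union> P \<union> W' \<union> P' \<Longrightarrow> i \<notin> W \<union> W' \<union> Mu \<union> My \<Longrightarrow> x i = f i"
        "\<And>i. i \<in> W \<union> W' \<union> Mu \<union> My \<Longrightarrow> i \<notin> W \<union> P \<union> W' \<union> P' \<Longrightarrow> x i = v i"
      using x unfolding assms(14)[symmetric] by (rule linkingE) blast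
    have fv: "f i = v i" if "i \<in> W \<union> W'" for i
      using that link_x(1)[of i] by auto
    have xf: "x i = f i" if "i \<in> P \<union> P'" for i
      using that link_x(2) disj by blast
    have xv: "x i = v i" if "i \<in> Mu \<union> My" for i
      using that link_x(3) disj by blast
    obtain f1 f2 where f12: "f1 \<in> V1" "f2 \<in> V2" "f = f1 + f2"
      using f by (rule set_plus_elim)
    obtain m s where m: "m \<in> V_WM" and s: "s \<in> V2"
      and link_z: "\<And>i. i \<in> W' \<union> My \<Longrightarrow> i \<in> W' \<union> P' \<Longrightarrow> m i = s i"
        "\<And>i. i \<in> W' \<union> My \<Longrightarrow> i \<notin> W' \<union> P' \<Longrightarrow> z i = m i"
        "\<And>i. i \<in> W' \<union> P' \<Longrightarrow> i \<notin> W' \<union> My \<Longrightarrow> z i = s i"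
        "\<And>i. i \<in> W' \<union> My \<longleftrightarrow> i \<in> W' \<union> P' \<Longrightarrow> z i = 0"
      using z unfolding assms(17) by (rule linkingE) blast
    have ms: "m i = s i" if "i \<in> W'" for i
      using that link_z(1)[of i] by auto
    have zm: "z i = m i" if "i \<in> My" for i
      using that link_z(2) disj by blast
    have zs: "z i = s i" if "i \<in> P'" for i
      using that link_z(3) disj by blast
    have z0: "z i = 0" if "i \<notin> My \<union> P'" for i
      using that link_z(4)[of i] by auto
    \<comment> \<open>On \<open>Mu \<union> My\<close> the sum \<open>v + m\<close> agrees with \<open>x + z = r\<close>, which vanishes there.\<close>
    have vm_zero: "(v + m) i = 0" if "i \<notin> W \<union> W'" for i
    proof -
      consider "i \<in> Mu" | "i \<in> My" | "i \<notin> W \<union> W' \<union> Mu \<union> My" using \<open>i \<notin> W \<union> W'\<close> by blast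
      then show ?thesis
      proof cases
        case 1
        then have "i \<notin> P \<union> P'" "i \<notin> My \<union> P'" "i \<notin> W' \<union> My" using disj(5)[OF 1] by auto
        then show ?thesis using 1 r0[of i] xv[of i] z0[of i] VM_zero[OF m, of i] by (simp add: r)
      next
        case 2
        then have "i \<notin> P \<union> P'" using disj(6) by blast
        then show ?thesis using 2 r0[of i] xv[of i] zm[of i] by (simp add: r)
      next
        case 3
        then show ?thesis using V_zero[OF v, of i] VM_zero[OF m, of i] by simp
      qed
    qed
    have g: "v + m \<in> V_WW"
      using v m vm_zero by (auto simp: assms(18) contraction_def vectors_on_def set_plus_intro)
    \<comment> \<open>The \<open>V2\<close>-vector \<open>f2 + s\<close> is \<open>(b, p')\<close>: it agrees with \<open>v + m\<close> on \<open>W'\<close> and with \<open>r\<close> on \<open>P'\<close>.\<close>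
    show "r \<in> linking (W \<union> P \<union> W' \<union> P') (V1 + V2) (W \<union> W') V_WW"
    proof (rule linkingI[OF set_plus_intro[OF f12(1) space_on_add[OF lin_V2 f12(2) s]] g])
      fix i
      assume "i \<in> W \<union> W'"
      then have "m i = s i"
        using ms VM_zero[OF m] V2_zero[OF s] disj(1) by (metis Un_iff)
      then show "(f1 + (f2 + s)) i = (v + m) i"
        using fv[OF \<open>i \<in> W \<union> W'\<close>] by (simp add: f12(3) add.assoc[symmetric])
    next
      fix i
      assume "i \<in> W \<union> P \<union> W' \<union> P'" "i \<notin> W \<union> W'"
      then have i: "i \<in> P \<union> P'" by auto
      then have "z i = s i"
        using zs z0 V2_zero[OF s] disj(3) by (metis Un_iff)
      then show "r i = (f1 + (f2 + s)) i"
        using xf[OF i] by (simp add: r f12(3) add.assoc)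
    next
      fix i
      assume "i \<in> W \<union> P \<union> W' \<union> P' \<longleftrightarrow> i \<in> W \<union> W'"
      then have "i \<notin> P \<union> P'" using disj(3,4) by blast
      then show "r i = 0" by (rule r0)
    qed auto
  qed
qed

end
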